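(* There is an absolute constant $C>0$ such that the following holds. Let $p$ be a prime, let $x,y\in\mathbb{Z}$ with $p\nmid y$, and let $\mathscr{W}$ be any set of integers that are pairwise incongruent modulo $p$. Then \[ \sum_{w\in\mathscr{W}}|S(x,y,w;p)|\leq C\,(\#\mathscr{W})^{3/4}\,p . \]
   Context: For a prime $p$, write $\mathrm{e}_p(t)=\exp(2\pi i t/p)$, and for an integer $m$ not divisible by $p$ let $\overline{m}$ denote the unique integer in $\{1,\ldots,p-1\}$ with $m\overline{m}\equiv 1\pmod p$. For integers $x,y,w$, \[ S(x,y,w;p)=\sum_{\substack{1\leq m<p\\ p\nmid (m+w)}}\mathrm{e}_p\bigl(x\overline{m}+y\,\overline{m+w}\bigr). \] *)

theory Defs
  imports "HOL-Analysis.Analysis" "HOL-Number_Theory.Number_Theory"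
begin

definition e_mod :: "int \<Rightarrow> int \<Rightarrow> complex" where
  "e_mod p t = exp (2 * of_real pi * \<i> * of_int t / of_int p)"

text \<open>
  For a prime \<open>p\<close> and \<open>m\<close> not divisible by \<open>p\<close>, the value \<open>modular_inverse p m\<close> is the unique
  inverse of \<open>m\<close> modulo \<open>p\<close> in \<open>{1..p - 1}\<close>. It is only applied to such \<open>m\<close> below.
\<close>

definition S_sum :: "int \<Rightarrow> int \<Rightarrow> int \<Rightarrow> int \<Rightarrow> complex" where
  "S_sum x y w p =
     (\<Sum>m \<in> {m. 1 \<le> m \<and> m < p \<and> \<not> p dvd (m + w)}.
        e_mod p (x * modular_inverse p m + y * modular_inverse p (m + w)))"

end

(*
  For w not divisible by p, the substitution u = (m + w) / m turns S(x, y, w; p) into the sum of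
  e_p(phi(u) / w) over the u other than 0 and 1 mod p, where phi(u) = (u - 1) (x + y / u).
  Since w now enters only through the frequency 1 / w, completing the sum over w to all
  frequencies shows that the second moment is at most p times the number of pairs with
  phi(u) = phi(u'). Clearing denominators, such a pair satisfies u = u' or x u u' = -y, so there
  are at most 2 p of them, whatever x is. Cauchy-Schwarz then bounds the sum over W by a multiple
  of (#W)^(1/2) p; the at most one w divisible by p contributes at most p.
*)
theory Submission
  imports Defs
begin

section \<open>Additive characters modulo \<open>p\<close> and second moments of exponential
  sums\<close>

lemma e_mod_add: "e_mod p (a + b) = e_mod p a * e_mod p b"
  by (simp add: e_mod_def ring_distribs add_divide_distrib exp_add)

lemma e_mod_eq_cis: "e_mod p t = cis (2 * pi * (of_int t / of_int p))"
  by (simp add: e_mod_def cis_conv_exp mult_ac)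

lemma norm_e_mod [simp]: "norm (e_mod p t) = 1"
  by (simp add: e_mod_eq_cis)

lemma cnj_e_mod: "cnj (e_mod p t) = e_mod p (- t)"
  by (simp add: e_mod_eq_cis cis_cnj)

lemma e_mod_eq_1_iff:
  assumes "p \<noteq> 0"
  shows "e_mod p t = 1 \<longleftrightarrow> p dvd t"
proof -
  have "e_mod p t = 1 \<longleftrightarrow> (\<exists>n::int. 2 * pi * (of_int t / of_int p) = of_int (2 * n) * pi)"
    unfolding e_mod_eq_cis cis_conv_exp by (simp add: exp_eq_1)
  also have "\<dots> \<longleftrightarrow> (\<exists>n::int. of_int t = (of_int (p * n) :: real))"
    using assms by (auto simp: field_simps)
  also have "\<dots> \<longleftrightarrow> p dvd t"
    unfolding of_int_eq_iff by (auto simp: dvd_def)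
  finally show ?thesis .
qed

lemma e_mod_cong:
  assumes "p \<noteq> 0" "[a = b] (mod p)"
  shows "e_mod p a = e_mod p b"
proof -
  have "e_mod p (a - b) = 1"
    using assms by (simp add: e_mod_eq_1_iff cong_iff_dvd_diff)
  then show ?thesis
    using e_mod_add[of p "a - b" b] by simp
qed

text \<open>Orthogonality: multiplying the sum by \<open>e_mod p a\<close> shifts \<open>v\<close>
  by one and so permutes the residues. The sum is therefore fixed by this factor and vanishes when
  the factor is not 1.\<close>

lemma sum_e_mod:
  fixes p a :: int
  assumes "p > 0"
  shows "(\<Sum>v\<in>{0..<p}. e_mod p (v * a)) = (if p dvd a then of_int p else 0)"
proof (cases "p dvd a")
  case True
  then have "e_mod p (v * a) = 1" for v
    using assms by (simp add: e_mod_eq_1_iff)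
  then show ?thesis
    using True assms by simp
next
  case False
  let ?s = "\<Sum>v\<in>{0..<p}. e_mod p (v * a)"
  have "?s * e_mod p a = (\<Sum>v\<in>{0..<p}. e_mod p ((v + 1) * a))"
    by (simp add: sum_distrib_right e_mod_add[symmetric] ring_distribs)
  also have "\<dots> = ?s"
  proof (rule sum.reindex_bij_witness[where i = "\<lambda>v. (v - 1) mod p" and j = "\<lambda>v. (v + 1) mod p"])
    fix v
    show "e_mod p ((v + 1) mod p * a) = e_mod p ((v + 1) * a)"
      using assms by (intro e_mod_cong cong_mult) auto
  qed (use assms in \<open>auto simp: mod_simps\<close>)
  finally have "?s * (e_mod p a - 1) = 0"
    by (simp add: ring_distribs)
  moreover have "e_mod p a \<noteq> 1"
    using False assms by (simp add: e_mod_eq_1_iff)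
  ultimately show ?thesis
    using False by simp
qed

text \<open>Expanding the square gives a sum over pairs \<open>u\<close>, \<open>u'\<close>;
  orthogonality in \<open>v\<close> keeps exactly the pairs on which \<open>f\<close> agrees modulo
  \<open>p\<close>, each with weight \<open>p\<close>.\<close>

lemma second_moment_e_mod:
  fixes p :: int and f :: "'a \<Rightarrow> int"
  assumes "p > 0" "finite J"
  shows "(\<Sum>v\<in>{0..<p}. (norm (\<Sum>u\<in>J. e_mod p (v * f u)))\<^sup>2)
         = of_int p * (\<Sum>u\<in>J. real (card {u'\<in>J. [f u = f u'] (mod p)}))"
proof -
  \<comment> \<open>The computation runs in the complex numbers, where a squared norm is
    \<open>z * cnj z\<close>, and is read back as a real identity at the end.\<close>
  have "complex_of_real (\<Sum>v\<in>{0..<p}. (norm (\<Sum>u\<in>J. e_mod p (v * f u)))\<^sup>2)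
      = (\<Sum>v\<in>{0..<p}. \<Sum>u\<in>J. \<Sum>u'\<in>J. e_mod p (v * (f u - f u')))"
    by (simp add: complex_norm_square[unfolded of_real_power] sum_product cnj_e_mod
        e_mod_add[symmetric] right_diff_distrib)
  also have "\<dots> = (\<Sum>u\<in>J. \<Sum>u'\<in>J. \<Sum>v\<in>{0..<p}. e_mod p (v * (f u - f u')))"
    by (subst sum.swap) (intro sum.cong refl sum.swap)
  also have "\<dots> = (\<Sum>u\<in>J. \<Sum>u'\<in>J. if [f u = f u'] (mod p) then of_int p else 0)"
    using assms by (simp add: sum_e_mod cong_iff_dvd_diff)
  also have "\<dots> = complex_of_real (of_int p * (\<Sum>u\<in>J. real (card {u'\<in>J. [f u = f u'] (mod p)})))"
    using assms by (simp add: sum.If_cases sum_distrib_left mult.commute Int_def conj_commute)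
  finally show ?thesis
    by (simp only: of_real_eq_iff)
qed

section \<open>Arithmetic modulo a prime and the sums \<open>S_sum\<close>\<close>

context
  fixes p :: int
  assumes p: "prime p"
begin

lemma coprime_if_not_dvd: "\<not> p dvd a \<Longrightarrow> coprime a p"
  using p prime_imp_coprime by (metis coprime_commute)

lemma modular_inverse_cancel:
  "\<not> p dvd a \<Longrightarrow> [a * modular_inverse p a = 1] (mod p)"
  by (intro cong_modular_inverse1 coprime_if_not_dvd)

lemma not_dvd_modular_inverse: "\<not> p dvd a \<Longrightarrow> \<not> p dvd modular_inverse p a"
  using modular_inverse_cancel[of a] p
  by (metis cong_dvd_iff dvd_mult not_prime_unit)

lemma cong_mult_cancel: "\<not> p dvd c \<Longrightarrow> [c * a = c * b] (mod p) \<longleftrightarrow> [a = b] (mod p)"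
  by (intro cong_mult_lcancel coprime_if_not_dvd)

lemma cong_imp_eq: "[a = b] (mod p) \<Longrightarrow> a \<in> {0..<p} \<Longrightarrow> b \<in> {0..<p} \<Longrightarrow> a = b"
  by (simp add: cong_def)

text \<open>With u = 1 + w/m one has 1/m = (u - 1)/w and 1/(m + w) = 1/(m u) = (u - 1)/(w u), so 1/w
  factors out of the phase. The range \<open>{2..<p}\<close> represents the residues other than 0
  and 1.\<close>

lemma S_sum_eq_frequency_sum:
  assumes w: "\<not> p dvd w"
  shows "S_sum x y w p = (\<Sum>u\<in>{2..<p}.
           e_mod p (modular_inverse p w * ((u - 1) * (x + y * modular_inverse p u))))"
proof -
  have p1: "p > 1"
    using p by (simp add: prime_gt_1_int)
  define M where "M = {m. 1 \<le> m \<and> m < p \<and> \<not> p dvd (m + w)}"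
  \<comment> \<open>\<open>j\<close> is the substitution u = (m + w)/m and \<open>i\<close> its
    inverse m = w/(u - 1).\<close>
  define j where "j m = ((m + w) * modular_inverse p m) mod p" for m
  define i where "i u = (w * modular_inverse p (u - 1)) mod p" for u
  have j: "[m * j m = m + w] (mod p)" if "\<not> p dvd m" for m
  proof -
    have "[m * j m = (m + w) * (m * modular_inverse p m)] (mod p)"
      by (simp add: j_def cong_def mod_simps mult_ac)
    also have "[(m + w) * (m * modular_inverse p m) = (m + w) * 1] (mod p)"
      using that by (intro cong_mult cong_refl modular_inverse_cancel)
    finally show ?thesis by simp
  qed
  have i: "[(u - 1) * i u = w] (mod p)" if "\<not> p dvd (u - 1)" for u
  proof -
    have "[(u - 1) * i u = w * ((u - 1) * modular_inverse p (u - 1))] (mod p)"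
      by (simp add: i_def cong_def mod_simps mult_ac)
    also have "[w * ((u - 1) * modular_inverse p (u - 1)) = w * 1] (mod p)"
      using that by (intro cong_mult cong_refl modular_inverse_cancel)
    finally show ?thesis by simp
  qed
  have M: "m \<in> {0..<p}" "\<not> p dvd m" "\<not> p dvd (m + w)" if "m \<in> M" for m
    using that by (auto simp: M_def zdvd_not_zless)
  have U: "u \<in> {0..<p}" "\<not> p dvd u" "\<not> p dvd (u - 1)" if "u \<in> {2..<p}" for u
    using that by (auto simp: zdvd_not_zless)
  have range: "j m \<in> {0..<p}" "i u \<in> {0..<p}" for m u
    using p1 by (auto simp: j_def i_def)
  have jM: "j m \<in> {2..<p}" if "m \<in> M" for m
  proof -
    \<comment> \<open>The value 0 would force \<open>p dvd m + w\<close>, and the value 1 would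
      force \<open>p dvd w\<close>.\<close>
    have "j m \<noteq> 0"
      using j[OF M(2)[OF that]] M(3)[OF that] by (auto simp: cong_iff_dvd_diff dvd_diff_commute)
    moreover have "j m \<noteq> 1"
      using j[OF M(2)[OF that]] w by (auto simp: cong_iff_dvd_diff)
    ultimately show ?thesis
      using range(1)[of m] by auto
  qed
  have iM: "i u \<in> M" if "u \<in> {2..<p}" for u
  proof -
    have iu: "[(u - 1) * i u = w] (mod p)"
      by (rule i[OF U(3)[OF that]])
    have ni: "\<not> p dvd i u"
      using iu w by (metis cong_dvd_iff dvd_mult)
    then have "i u \<noteq> 0" by auto
    moreover have "[u * i u = i u + w] (mod p)"
      using cong_add[OF cong_refl[of "i u"] iu] by (simp add: algebra_simps)
    then have "\<not> p dvd (i u + w)"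
      using U(2)[OF that] ni p by (metis cong_dvd_iff prime_dvd_mult_iff)
    ultimately show ?thesis
      using range(2)[of u] by (auto simp: M_def)
  qed
  have ij: "i (j m) = m" if "m \<in> M" for m
  proof (rule cong_imp_eq)
    have nd: "\<not> p dvd (j m - 1)"
      using U(3) jM that by blast
    have "[(j m - 1) * m = w] (mod p)"
      using j[OF M(2)[OF that]] by (simp add: cong_iff_dvd_diff algebra_simps)
    then have "[(j m - 1) * i (j m) = (j m - 1) * m] (mod p)"
      using i[OF nd] cong_sym cong_trans by blast
    then show "[i (j m) = m] (mod p)"
      using nd by (simp add: cong_mult_cancel)
  qed (use range M(1)[OF that] in auto)
  have ji: "j (i u) = u" if "u \<in> {2..<p}" for u
  proof (rule cong_imp_eq)
    have nd: "\<not> p dvd i u"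
      using M(2) iM that by blast
    have "[i u * u = i u + w] (mod p)"
      using i[OF U(3)[OF that]] by (simp add: cong_iff_dvd_diff algebra_simps)
    then have "[i u * j (i u) = i u * u] (mod p)"
      using j[OF nd] cong_sym cong_trans by blast
    then show "[j (i u) = u] (mod p)"
      using nd by (simp add: cong_mult_cancel)
  qed (use range U(1)[OF that] in auto)
  have phase: "e_mod p (modular_inverse p w * ((j m - 1) * (x + y * modular_inverse p (j m))))
      = e_mod p (x * modular_inverse p m + y * modular_inverse p (m + w))" if "m \<in> M" for m
  proof -
    note m = M[OF that]
    let ?a = "modular_inverse p m" and ?b = "modular_inverse p (m + w)"
      and ?c = "modular_inverse p w" and ?d = "modular_inverse p (j m)"
    have nj: "\<not> p dvd j m"
      using U(2) jM that by blast
    \<comment> \<open>Both sides of (u - 1)/w = 1/m become 1 after multiplication by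
      \<open>m\<close>, which is then cancelled.\<close>
    have "[m * (?c * (j m - 1)) = ?c * (m * j m) - ?c * m] (mod p)"
      by (simp add: algebra_simps)
    also have "[?c * (m * j m) - ?c * m = ?c * (m + w) - ?c * m] (mod p)"
      using j[OF m(2)] by (intro cong_diff cong_mult cong_refl)
    also have "?c * (m + w) - ?c * m = w * ?c"
      by (simp add: algebra_simps)
    also have "[w * ?c = 1] (mod p)"
      using w by (rule modular_inverse_cancel)
    also have "[1 = m * ?a] (mod p)"
      using m by (intro cong_sym[OF modular_inverse_cancel])
    finally have 1: "[?c * (j m - 1) = ?a] (mod p)"
      using m by (simp add: cong_mult_cancel)
    \<comment> \<open>Likewise 1/(m u) = 1/(m + w) is checked after multiplication by m + w = m
      u.\<close>
    have "[(m + w) * (?a * ?d) = (m * j m) * (?a * ?d)] (mod p)"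
      by (rule cong_mult[OF cong_sym[OF j[OF m(2)]] cong_refl])
    also have "(m * j m) * (?a * ?d) = (m * ?a) * (j m * ?d)"
      by (simp add: mult_ac)
    also have "[(m * ?a) * (j m * ?d) = 1 * 1] (mod p)"
      using m nj by (intro cong_mult modular_inverse_cancel)
    also have "[1 * 1 = (m + w) * ?b] (mod p)"
      using cong_sym[OF modular_inverse_cancel[OF m(3)]] by simp
    finally have 2: "[?a * ?d = ?b] (mod p)"
      using m by (simp add: cong_mult_cancel)
    have "[?c * ((j m - 1) * (x + y * ?d)) = (?c * (j m - 1)) * (x + y * ?d)] (mod p)"
      by (simp add: mult_ac)
    also have "[(?c * (j m - 1)) * (x + y * ?d) = ?a * (x + y * ?d)] (mod p)"
      by (intro cong_mult cong_refl 1)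
    also have "?a * (x + y * ?d) = x * ?a + y * (?a * ?d)"
      by (simp add: algebra_simps)
    also have "[x * ?a + y * (?a * ?d) = x * ?a + y * ?b] (mod p)"
      by (intro cong_add cong_mult cong_refl 2)
    finally show ?thesis
      using p1 by (intro e_mod_cong) auto
  qed
  show ?thesis
    unfolding S_sum_def M_def[symmetric]
    by (rule sum.reindex_bij_witness[where i = i and j = j]) (use ij ji iM jM phase in auto)
qed

text \<open>Multiplying the congruence by u u' and subtracting leaves (u - u')(x u u' + y), so a
  prime \<open>p\<close> divides one of the two factors. Each factor allows at most one
  \<open>u'\<close>.\<close>

lemma card_phase_fibre_le:
  assumes y: "\<not> p dvd y" and u: "u \<in> {2..<p}"
  shows "card {u'\<in>{2..<p}. [(u - 1) * (x + y * modular_inverse p u)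
                         = (u' - 1) * (x + y * modular_inverse p u')] (mod p)} \<le> 2"
    (is "card ?F \<le> 2")
proof -
  have nd: "\<not> p dvd v" if "v \<in> {2..<p}" for v
    using that by (auto simp: zdvd_not_zless)
  \<comment> \<open>The solutions coming from the second factor.\<close>
  define B where "B = {u'\<in>{2..<p}. p dvd (x * u * u' + y)}"
  have finB: "finite B"
    by (rule finite_subset[of _ "{2..<p}"]) (auto simp: B_def)
  have clear: "[v * ((v - 1) * (x + y * modular_inverse p v)) = (v - 1) * (v * x + y)] (mod p)"
    if "v \<in> {2..<p}" for v
  proof -
    have "v * ((v - 1) * (x + y * modular_inverse p v))
        = (v - 1) * (v * x + y * (v * modular_inverse p v))"
      by (simp add: algebra_simps)
    also have "[\<dots> = (v - 1) * (v * x + y * 1)] (mod p)"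
      using nd[OF that] by (intro cong_mult cong_add cong_refl modular_inverse_cancel)
    finally show ?thesis by simp
  qed
  have "u' = u \<or> u' \<in> B" if "u' \<in> ?F" for u'
  proof -
    let ?f = "\<lambda>v. (v - 1) * (x + y * modular_inverse p v)"
    have u': "u' \<in> {2..<p}" and eq: "[?f u = ?f u'] (mod p)"
      using that by auto
    have "[u' * ((u - 1) * (u * x + y)) = u' * (u * ?f u)] (mod p)"
      by (rule cong_mult[OF cong_refl cong_sym[OF clear[OF u]]])
    also have "[u' * (u * ?f u) = u' * (u * ?f u')] (mod p)"
      by (intro cong_mult cong_refl eq)
    also have "u' * (u * ?f u') = u * (u' * ?f u')"
      by (simp add: mult_ac)
    also have "[\<dots> = u * ((u' - 1) * (u' * x + y))] (mod p)"
      by (rule cong_mult[OF cong_refl clear[OF u']])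
    finally have "p dvd (u - u') * (x * u * u' + y)"
      by (simp add: cong_iff_dvd_diff algebra_simps)
    then consider "p dvd (u - u')" | "p dvd (x * u * u' + y)"
      using p by (auto simp: prime_dvd_mult_iff)
    then show ?thesis
    proof cases
      case 1
      then have "u = u'"
        using u u' by (intro cong_imp_eq) (auto simp: cong_iff_dvd_diff)
      then show ?thesis by simp
    qed (use u' in \<open>auto simp: B_def\<close>)
  qed
  then have "?F \<subseteq> insert u B" by blast
  moreover have "card B \<le> 1"
  proof -
    have "a = b" if "a \<in> B" "b \<in> B" for a b
    proof (rule cong_imp_eq)
      \<comment> \<open>If \<open>p\<close> divided \<open>x * u\<close>, membership of
        \<open>a\<close> in \<open>B\<close> would give \<open>p dvd y\<close>. Hence, once
        \<open>B\<close> has an element, the linear congruence defining it has a unique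
        solution.\<close>
      have "\<not> p dvd (x * u)"
        using that y by (metis (no_types, lifting) B_def dvd_add_right_iff dvd_mult2 mem_Collect_eq)
      moreover have "[x * u * a = x * u * b] (mod p)"
        using that dvd_diff[of p "x * u * a + y" "x * u * b + y"]
        by (simp add: B_def cong_iff_dvd_diff)
      ultimately show "[a = b] (mod p)"
        by (simp add: cong_mult_cancel)
    qed (use that in \<open>auto simp: B_def\<close>)
    with finB show ?thesis
      by (simp add: card_le_Suc0_iff_eq)
  qed
  ultimately show ?thesis
    using card_mono[of "insert u B" ?F] card_insert_le_m1[of 2 B u] finB by simp
qed

text \<open>Incongruent \<open>w\<close> have distinct inverses, so the sum is part of a complete
  second moment over all frequencies, which the fibre bound controls.\<close>

lemma sum_norm_S_sum_sq_le:
  assumes y: "\<not> p dvd y"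
    and W: "pairwise (\<lambda>u v. \<not> [u = v] (mod p)) W" "\<And>w. w \<in> W \<Longrightarrow> \<not> p dvd w"
  shows "(\<Sum>w\<in>W. (norm (S_sum x y w p))\<^sup>2) \<le> 2 * (of_int p)\<^sup>2"
proof -
  have p1: "p > 1"
    using p by (simp add: prime_gt_1_int)
  define T where "T v = (norm (\<Sum>u\<in>{2..<p}.
      e_mod p (v * ((u - 1) * (x + y * modular_inverse p u)))))\<^sup>2" for v
  have inj: "inj_on (modular_inverse p) W"
  proof (rule inj_onI)
    fix a b assume ab: "a \<in> W" "b \<in> W" "modular_inverse p a = modular_inverse p b"
    have "[modular_inverse p a * a = modular_inverse p a * b] (mod p)"
      using modular_inverse_cancel[of a] modular_inverse_cancel[of b] W(2) ab
      by (metis cong_sym cong_trans mult.commute)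
    then have "[a = b] (mod p)"
      using not_dvd_modular_inverse W(2) ab by (simp add: cong_mult_cancel)
    then show "a = b"
      using W(1) ab by (auto simp: pairwise_def)
  qed
  have "(\<Sum>w\<in>W. (norm (S_sum x y w p))\<^sup>2) = (\<Sum>w\<in>W. T (modular_inverse p w))"
    using W(2) by (simp add: T_def S_sum_eq_frequency_sum)
  also have "\<dots> = sum T (modular_inverse p ` W)"
    by (simp add: sum.reindex[OF inj])
  \<comment> \<open>The frequencies 1/w lie in \<open>{0..<p}\<close>; the added terms are squares,
    hence nonnegative.\<close>
  also have "\<dots> \<le> sum T {0..<p}"
    using p1 modular_inverse_int_nonneg modular_inverse_int_less
    by (intro sum_mono2) (auto simp: T_def)
  also have "\<dots> = of_int p * (\<Sum>u\<in>{2..<p}. real (card {u'\<in>{2..<p}.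
      [(u - 1) * (x + y * modular_inverse p u) = (u' - 1) * (x + y * modular_inverse p u')] (mod p)}))"
    unfolding T_def using p1 by (intro second_moment_e_mod) auto
  also have "\<dots> \<le> of_int p * (\<Sum>u\<in>{2..<p}. real 2)"
    using p1 by (intro mult_left_mono sum_mono of_nat_mono card_phase_fibre_le[OF y]) auto
  \<comment> \<open>The range of \<open>u\<close> has p - 2 elements, rounded up to p.\<close>
  also have "\<dots> \<le> of_int p * (2 * of_int p)"
    using p1 by (intro mult_left_mono) auto
  finally show ?thesis
    by (simp add: power2_eq_square)
qed

text \<open>The trivial bound, meant for \<open>w\<close> divisible by \<open>p\<close>, where the
  substitution degenerates to u = 1.\<close>

lemma norm_S_sum_le: "norm (S_sum x y w p) \<le> of_int p"
proof -
  have "norm (S_sum x y w p) \<le> (\<Sum>m\<in>{m. 1 \<le> m \<and> m < p \<and> \<not> p dvd (m + w)}. 1)"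
    unfolding S_sum_def by (intro sum_norm_le) simp
  also have "\<dots> \<le> (\<Sum>m\<in>{0..<p}. 1)"
    by (intro sum_mono2) auto
  also have "\<dots> = of_int p"
    using p by (simp add: prime_ge_0_int)
  finally show ?thesis .
qed

text \<open>The constant is 3 = 1 + 2: the trivial bound for the at most one multiple of
  \<open>p\<close> in \<open>W\<close>, and Cauchy-Schwarz with the mean square for the
  rest.\<close>

lemma sum_norm_S_sum_le:
  assumes y: "\<not> p dvd y" and W: "pairwise (\<lambda>u v. \<not> [u = v] (mod p)) W"
    and fin: "finite W" "W \<noteq> {}"
  shows "(\<Sum>w\<in>W. norm (S_sum x y w p)) \<le> 3 * sqrt (card W) * of_int p"
proof -
  have p0: "p > 0"
    using p by (simp add: prime_gt_0_int)
  define A where "A = {w\<in>W. p dvd w}"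
  define B where "B = {w\<in>W. \<not> p dvd w}"
  have "a = b" if "a \<in> A" "b \<in> A" for a b
    using W that by (simp add: A_def pairwise_def cong_iff_dvd_diff) (metis dvd_diff)
  then have "card A \<le> 1"
    using fin by (simp add: A_def card_le_Suc0_iff_eq)
  have "(\<Sum>w\<in>A. norm (S_sum x y w p)) \<le> real (card A) * of_int p"
    using norm_S_sum_le by (rule sum_bounded_above)
  also have "\<dots> \<le> 1 * of_int p"
    using \<open>card A \<le> 1\<close> p0 by (intro mult_right_mono) auto
  \<comment> \<open>As \<open>W\<close> is nonempty, its cardinality is at least 1.\<close>
  also have "\<dots> \<le> sqrt (card W) * of_int p"
    using fin p0 by (intro mult_right_mono) (auto simp: Suc_le_eq card_gt_0_iff)
  finally have A: "(\<Sum>w\<in>A. norm (S_sum x y w p)) \<le> sqrt (card W) * of_int p" .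
  have "(\<Sum>w\<in>B. norm (S_sum x y w p) * 1)\<^sup>2
      \<le> (\<Sum>w\<in>B. (norm (S_sum x y w p))\<^sup>2) * (\<Sum>w\<in>B. 1\<^sup>2)"
    by (rule Cauchy_Schwarz_ineq_sum)
  also have "\<dots> \<le> (2 * (of_int p)\<^sup>2) * real (card W)"
    using y W fin by (intro mult_mono sum_norm_S_sum_sq_le)
      (auto simp: B_def pairwise_def intro!: card_mono)
  \<comment> \<open>The constant sqrt 2 is rounded up to 2.\<close>
  also have "\<dots> \<le> (2 * sqrt (card W) * of_int p)\<^sup>2"
    by (simp add: power_mult_distrib)
  finally have "(\<Sum>w\<in>B. norm (S_sum x y w p)) \<le> 2 * sqrt (card W) * of_int p"
    using p0 by (simp add: power2_le_iff_abs_le abs_of_nonneg sum_nonneg)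
  moreover have "(\<Sum>w\<in>W. norm (S_sum x y w p))
      = (\<Sum>w\<in>A. norm (S_sum x y w p)) + (\<Sum>w\<in>B. norm (S_sum x y w p))"
    using fin by (subst sum.union_disjoint[symmetric]) (auto simp: A_def B_def intro!: sum.cong)
  ultimately show ?thesis
    using A by linarith
qed

end

theorem proposition4p2:
  shows "\<exists>C::real. C > 0 \<and>
    (\<forall>(p::int) (x::int) (y::int) (W::int set).
       prime p \<longrightarrow> \<not> p dvd y \<longrightarrow>
       pairwise (\<lambda>u v. \<not> [u = v] (mod p)) W \<longrightarrow>
       (\<Sum>w\<in>W. norm (S_sum x y w p)) \<le> C * real (card W) powr (3/4) * of_int p)"
proof (intro exI[of _ 3] conjI allI impI)
  fix p x y :: int and W :: "int set"
  assume p: "prime p" and y: "\<not> p dvd y"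
    and W: "pairwise (\<lambda>u v. \<not> [u = v] (mod p)) W"
  show "(\<Sum>w\<in>W. norm (S_sum x y w p)) \<le> 3 * real (card W) powr (3/4) * of_int p"
  proof (cases "finite W \<and> W \<noteq> {}")
    case True
    then have "real (card W) \<ge> 1"
      by (simp add: Suc_le_eq card_gt_0_iff)
    \<comment> \<open>Exponent 1/2 is stronger than 3/4 because the base is at least 1.\<close>
    then have "sqrt (card W) \<le> real (card W) powr (3/4)"
      by (simp add: powr_half_sqrt[symmetric] powr_mono)
    then have "3 * sqrt (card W) * of_int p \<le> 3 * real (card W) powr (3/4) * of_int p"
      using p by (intro mult_right_mono) (auto simp: prime_ge_0_int)
    then show ?thesis
      using sum_norm_S_sum_le[OF p y W, of x] True by linarith
  \<comment> \<open>For \<open>W\<close> empty, or infinite under the conventions for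
    \<open>sum\<close> and \<open>card\<close>, both sides are 0.\<close>
  qed auto
qed simp

end
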